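(* Let $X$ be an infinite topological space and let $\kappa,\lambda$ be infinite cardinal numbers. If $X$ has precaliber $\kappa$ and $\operatorname{cf}(\kappa)>\omega$, then the topological power $X^{\lambda}$ also has precaliber $\kappa$.
   Context: For a topological space $X$, $\tau_X^{+}$ denotes the set of all non-empty open subsets of $X$. For an infinite cardinal $\kappa$, $\operatorname{cf}(\kappa)$ is its cofinality (in the usual sense), and $[I]^{\kappa}$ denotes $\{J\subseteq I : |J|=\kappa\}$. An indexed family $\{U_\gamma : \gamma\in J\}\subseteq\tau_X^{+}$ (repetitions allowed, $J\neq\emptyset$) is centered if $\bigcap\{U_\gamma : \gamma\in F\}\neq\emptyset$ for every non-empty finite $F\subseteq J$. A space $X$ has precaliber $\kappa$ (equivalently, $\kappa$ is a precaliber for $X$) if for every set $I$ of cardinality $\kappa$ and every indexed family $\{U_\gamma : \gamma\in I\}\subseteq\tau_X^{+}$ (repetitions allowed) there is $J\in[I]^{\kappa}$ such that $\{U_\gamma : \gamma\in J\}$ is centered. Powers carry the product (Tychonoff) topology. No separation axioms are assumed. *)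

theory Defs
  imports "HOL-Analysis.Function_Topology"
begin

unbundle cardinal_syntax

text \<open>
  A cardinal is a relation \<open>\<kappa>\<close> that is a cardinal order (an initial ordinal) on its field.
  The library predicate \<open>cofinal\<close> asks for strict upper bounds; as an infinite cardinal has no
  last element, this agrees with unboundedness in the usual, non-strict form.
\<close>

lemma cofinal_iff_unbounded:
  assumes "Cinfinite \<kappa>" and "A \<subseteq> Field \<kappa>"
  shows "cofinal A \<kappa> \<longleftrightarrow> (\<forall>a\<in>Field \<kappa>. \<exists>b\<in>A. (a, b) \<in> \<kappa>)"
proof
  assume "cofinal A \<kappa>"
  then show "\<forall>a\<in>Field \<kappa>. \<exists>b\<in>A. (a, b) \<in> \<kappa>"
    unfolding cofinal_def by blast
next
  assume unb: "\<forall>a\<in>Field \<kappa>. \<exists>b\<in>A. (a, b) \<in> \<kappa>"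
  have co: "Card_order \<kappa>" and inf: "\<not> finite (Field \<kappa>)"
    using assms(1) by (auto simp: cinfinite_def)
  have tr: "trans \<kappa>" and an: "antisym \<kappa>"
    using co by (auto simp: card_order_on_def well_order_on_def linear_order_on_def
        partial_order_on_def preorder_on_def)
  show "cofinal A \<kappa>"
    unfolding cofinal_def
  proof
    fix a assume "a \<in> Field \<kappa>"
    then obtain c where c: "c \<in> Field \<kappa>" "a \<noteq> c" "(a, c) \<in> \<kappa>"
      using infinite_Card_order_limit[OF co inf] by blast
    then obtain b where b: "b \<in> A" "(c, b) \<in> \<kappa>"
      using unb by blast
    have "(a, b) \<in> \<kappa>"
      using transD[OF tr c(3) b(2)] .
    moreover have "a \<noteq> b"
      using antisymD[OF an c(3)] b(2) c(2) by auto
    ultimately show "\<exists>b\<in>A. a \<noteq> b \<and> (a, b) \<in> \<kappa>"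
      using b by blast
  qed
qed

definition cofinality :: "'k rel \<Rightarrow> 'k rel" where
  "cofinality \<kappa> = |SOME A. A \<subseteq> Field \<kappa> \<and> cofinal A \<kappa> \<and>
     (\<forall>B. B \<subseteq> Field \<kappa> \<and> cofinal B \<kappa> \<longrightarrow> |A| \<le>o |B| )|"

lemma cofinality_least:
  assumes "Cinfinite \<kappa>"
  shows "\<exists>A\<subseteq>Field \<kappa>. cofinal A \<kappa> \<and> cofinality \<kappa> = |A|"
    and "B \<subseteq> Field \<kappa> \<Longrightarrow> cofinal B \<kappa> \<Longrightarrow> cofinality \<kappa> \<le>o |B|"
proof -
  let ?R = "card_of ` {B. B \<subseteq> Field \<kappa> \<and> cofinal B \<kappa>}"
  have "\<exists>b\<in>Field \<kappa>. a \<noteq> b \<and> (a, b) \<in> \<kappa>" if "a \<in> Field \<kappa>" for a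
    using infinite_Card_order_limit[of \<kappa> a] assms that by (simp add: cinfinite_def)
  then have "cofinal (Field \<kappa>) \<kappa>"
    by (simp add: cofinal_def)
  then have "?R \<noteq> {}" by auto
  moreover have "\<forall>r\<in>?R. Card_order r"
    using card_of_Card_order by auto
  ultimately have "\<exists>r\<in>?R. \<forall>r'\<in>?R. r \<le>o r'"
    by (rule exists_minim_Card_order)
  then have "\<exists>A. A \<subseteq> Field \<kappa> \<and> cofinal A \<kappa> \<and>
      (\<forall>B. B \<subseteq> Field \<kappa> \<and> cofinal B \<kappa> \<longrightarrow> |A| \<le>o |B| )"
    by auto
  note least = someI_ex[OF this]
  show "\<exists>A\<subseteq>Field \<kappa>. cofinal A \<kappa> \<and> cofinality \<kappa> = |A|"
    unfolding cofinality_def using least by (metis (no_types, lifting))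
  show "cofinality \<kappa> \<le>o |B|" if "B \<subseteq> Field \<kappa>" "cofinal B \<kappa>"
    unfolding cofinality_def using least that by simp
qed

definition nonempty_opens :: "'a topology \<Rightarrow> 'a set set" where
  "nonempty_opens X = {U. openin X U \<and> U \<noteq> {}}"

definition centered :: "('i \<Rightarrow> 'a set) \<Rightarrow> 'i set \<Rightarrow> bool" where
  "centered U J \<longleftrightarrow>
     J \<noteq> {} \<and> (\<forall>F. F \<subseteq> J \<and> F \<noteq> {} \<and> finite F \<longrightarrow> (\<Inter>\<gamma>\<in>F. U \<gamma>) \<noteq> {})"

text \<open>
  The index sets range over the sets of cardinality \<open>\<kappa>\<close> in the type carrying \<open>\<kappa>\<close>, because a
  definition cannot quantify over types; by the lemma below this covers index sets in every type.
\<close>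

definition has_precaliber :: "'a topology \<Rightarrow> 'k rel \<Rightarrow> bool" where
  "has_precaliber X \<kappa> \<longleftrightarrow>
     (\<forall>(I :: 'k set) U. |I| =o \<kappa> \<and> (\<forall>\<gamma>\<in>I. U \<gamma> \<in> nonempty_opens X) \<longrightarrow>
        (\<exists>J. J \<subseteq> I \<and> |J| =o \<kappa> \<and> centered U J))"

lemma has_precaliber_any_index_type:
  fixes \<kappa> :: "'k rel" and I :: "'i set"
  assumes pre: "has_precaliber X \<kappa>" and "Card_order \<kappa>" and I: "|I| =o \<kappa>"
    and U: "\<forall>\<gamma>\<in>I. U \<gamma> \<in> nonempty_opens X"
  shows "\<exists>J. J \<subseteq> I \<and> |J| =o \<kappa> \<and> centered U J"
proof -
  have K: "|Field \<kappa>| =o \<kappa>"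
    using assms(2) by (rule card_of_Field_ordIso)
  have "|Field \<kappa>| =o |I|"
    using K I ordIso_symmetric ordIso_transitive by blast
  then obtain f where f: "bij_betw f (Field \<kappa>) I"
    using card_of_ordIso by blast
  then have "\<forall>\<gamma>\<in>Field \<kappa>. (U \<circ> f) \<gamma> \<in> nonempty_opens X"
    using U by (auto dest: bij_betwE)
  then obtain J where J: "J \<subseteq> Field \<kappa>" "|J| =o \<kappa>" "centered (U \<circ> f) J"
    using pre K unfolding has_precaliber_def by blast
  have "bij_betw f J (f ` J)"
    using f J(1) bij_betw_subset by blast
  then have "|f ` J| =o \<kappa>"
    using J(2) card_of_ordIsoI ordIso_symmetric ordIso_transitive by blast
  moreover have "f ` J \<subseteq> I"
    using f J(1) by (auto simp: bij_betw_def)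
  moreover have "centered U (f ` J)"
    unfolding centered_def
  proof (intro conjI allI impI)
    show "f ` J \<noteq> {}"
      using J(3) by (auto simp: centered_def)
    fix F assume F: "F \<subseteq> f ` J \<and> F \<noteq> {} \<and> finite F"
    then obtain G where G: "G \<subseteq> J" "finite G" "F = f ` G"
      using finite_subset_image by metis
    then show "(\<Inter>\<gamma>\<in>F. U \<gamma>) \<noteq> {}"
      using F J(3) by (auto simp: centered_def)
  qed
  ultimately show ?thesis by blast
qed

definition topological_power :: "'a topology \<Rightarrow> 'l rel \<Rightarrow> ('l \<Rightarrow> 'a) topology" where
  "topological_power X \<mu> = product_topology (\<lambda>_. X) (Field \<mu>)"

end

theory Submission
  imports Defs
begin

text \<open>
  The finite intersections are controlled coordinate by coordinate, so only finitely many
  applications of the precaliber of \<open>X\<close> are needed, and no \<open>\<Delta>\<close>-system has to be found: this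
  matters because \<open>\<kappa>\<close> may be singular, where the \<open>\<Delta>\<close>-system lemma fails.
  
  Shrink each member of the given family to a basic open box with a finite support.  As \<open>\<kappa>\<close> has
  uncountable cofinality, \<open>\<kappa>\<close> many of the boxes have supports of the same size \<open>n\<close>
  (\<open>uncountable_cofinality_pigeonhole\<close>).  Enumerate the support of the box with index \<open>\<gamma>\<close> as
  \<open>e \<gamma> 0, \<dots>, e \<gamma> (n - 1)\<close>.  Applying the precaliber of \<open>X\<close> once for each \<open>i < n\<close> leaves \<open>\<kappa>\<close> many
  indices for which, for each \<open>i\<close>, the \<open>i\<close>-th sides form a centered family
  (\<open>precaliber_finitely_many_families\<close>).  For finitely many of these indices choose a common point
  \<open>x i\<close> of the \<open>i\<close>-th sides.  The point of the power that takes the value \<open>x i\<close> at every coordinate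
  \<open>e \<gamma> i\<close> lies in all these boxes.
  
  This point is well defined if no coordinate is the \<open>i\<close>-th one for one box and the
  \<open>j\<close>-th one for another with \<open>i \<noteq> j\<close>, and the combinatorial heart of the proof is that this can be
  arranged by passing to \<open>\<kappa>\<close> many indices (\<open>large_family_separated_coordinates\<close>), for every infinite
  \<open>\<kappa>\<close>, regular or not.  Treating one \<open>i\<close> at a time, one needs a large free set: given
  points \<open>p \<gamma>\<close> and finite sets \<open>G \<gamma>\<close> of bounded size with \<open>p \<gamma> \<notin> G \<gamma>\<close>, there are \<open>\<kappa>\<close> many indices
  such that no \<open>p \<gamma>\<close> is in any \<open>G \<delta>\<close> (\<open>large_free_set\<close>).  If \<open>p\<close> has a fibre of size \<open>\<kappa>\<close>, that fibre
  is free.  If \<open>p\<close> takes \<open>\<kappa>\<close> many values, a maximality argument applies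
  (\<open>free_set_modulo_ideal\<close>).  Otherwise \<open>\<kappa>\<close> is a limit of sizes of sets on which both \<open>p\<close> and
  the relevant part of \<open>G\<close> are constant; the same maximality argument, carried out on a cofinal subset of
  \<open>\<kappa>\<close> of least possible order type, selects cofinally many of these sets whose union is free.
\<close>

section \<open>Sets smaller than a cardinal\<close>

text \<open>
  A set \<open>A\<close> is called small, with respect to a cardinal \<open>\<kappa>\<close>, if \<open>|A| <o \<kappa>\<close>.  For singular \<open>\<kappa>\<close> a small
  union of small sets can be large; the bound \<open>|Y|\<close> that the members share in \<open>small_UNION\<close> prevents this.
\<close>

lemma finite_small:
  assumes "Cinfinite \<kappa>" and "finite A"
  shows "|A| <o \<kappa>"
proof (rule finite_ordLess_infinite)
  show "Well_order |A|" by (rule card_of_Well_order)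
  show "Well_order \<kappa>" using assms(1) card_order_on_well_order_on by blast
  show "finite (Field |A| )" using assms(2) by (simp add: Field_card_of)
  show "\<not> finite (Field \<kappa>)" using assms(1) by (simp add: cinfinite_def)
qed

lemma small_UNION:
  assumes "Cinfinite \<kappa>" and "|T| <o \<kappa>" and "|Y| <o \<kappa>" and "\<And>t. t \<in> T \<Longrightarrow> |F t| \<le>o |Y|"
  shows "|\<Union>t\<in>T. F t| <o \<kappa>"
proof (cases "finite (T <+> Y)")
  case True
  then have "finite T" "finite Y" by auto
  moreover have "finite (F t)" if "t \<in> T" for t
    using assms(4)[OF that] \<open>finite Y\<close> card_of_ordLeq_finite by blast
  ultimately have "finite (\<Union>t\<in>T. F t)" by auto
  then show ?thesis by (rule finite_small[OF assms(1)])
next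
  case False
  have "|T <+> Y| <o \<kappa>"
    using card_of_Plus_ordLess_infinite_Field assms(1,2,3) cinfinite_def by blast
  moreover have "|\<Union>t\<in>T. F t| \<le>o |T <+> Y|"
    by (rule card_of_UNION_ordLeq_infinite[OF False])
      (use card_of_Plus1 card_of_Plus2 assms(4) ordLeq_transitive in blast)+
  ultimately show ?thesis
    using ordLeq_ordLess_trans by blast
qed

lemma small_subset:
  assumes "|A| <o \<kappa>" and "B \<subseteq> A"
  shows "|B| <o \<kappa>"
  using assms card_of_mono1 ordLeq_ordLess_trans by blast

lemma small_image:
  assumes "|A| <o \<kappa>" 
  shows "|f ` A| <o \<kappa>"
  using assms card_of_image ordLeq_ordLess_trans by blast

lemma small_Un:
  assumes "Cinfinite \<kappa>" and "|A| <o \<kappa>" and "|B| <o \<kappa>"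
  shows "|A \<union> B| <o \<kappa>"
  using assms card_of_Un_ordLess_infinite_Field unfolding cinfinite_def by blast

lemma small_UN_finite:
  assumes "Cinfinite \<kappa>" and "|S| <o \<kappa>" and "\<And>s. s \<in> S \<Longrightarrow> finite (G s) \<and> card (G s) \<le> m"
  shows "|\<Union>s\<in>S. G s| <o \<kappa>"
proof (rule small_UNION[OF assms(1,2)])
  show "|{..<m}| <o \<kappa>"
    using assms(1) by (rule finite_small) simp
  show "|G s| \<le>o |{..<m}|" if "s \<in> S" for s
    using assms(3)[OF that] 
    by (metis card_lessThan card_of_ordLeq finite_lessThan inj_on_iff_card_le[of "G s" "{..<m}"])
qed

lemma small_bounded_subsets:
  assumes "Cinfinite \<kappa>" and "|P| <o \<kappa>"
  shows "|{G. G \<subseteq> P \<and> finite G \<and> card G \<le> m}| <o \<kappa>"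
proof (induction m)
  case 0
  have "{G. G \<subseteq> P \<and> finite G \<and> card G \<le> 0} \<subseteq> {{}}" by auto
  then show ?case
    by (rule small_subset[OF finite_small[OF assms(1)], rotated]) simp
next
  case (Suc m)
  let ?A = "\<lambda>m. {G. G \<subseteq> P \<and> finite G \<and> card G \<le> m}"
  have "?A (Suc m) \<subseteq> {{}} \<union> (\<Union>G\<in>?A m. (\<lambda>x. insert x G) ` P)"
  proof
    fix G assume G: "G \<in> ?A (Suc m)"
    show "G \<in> {{}} \<union> (\<Union>G\<in>?A m. (\<lambda>x. insert x G) ` P)"
    proof (cases "G = {}")
      case False
      then obtain x where "x \<in> G" by blast
      then have "G - {x} \<in> ?A m" "x \<in> P" "G = insert x (G - {x})"
        using G by auto
      then show ?thesis by blast
    qed auto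
  qed
  moreover have "|\<Union>G\<in>?A m. (\<lambda>x. insert x G) ` P| <o \<kappa>"
    by (rule small_UNION[OF assms(1) Suc assms(2)]) (rule card_of_image)
  then have "|{{}} \<union> (\<Union>G\<in>?A m. (\<lambda>x. insert x G) ` P)| <o \<kappa>"
    by (rule small_Un[OF assms(1) finite_small[OF assms(1)], rotated]) simp
  ultimately show ?case
    by (metis (no_types, lifting) small_subset)
qed

lemma large_subset_full_size:
  assumes "|I| =o \<kappa>" and "J \<subseteq> I" and "\<not> |J| <o \<kappa>"
  shows "|J| =o \<kappa>"
proof -
  have "|J| \<le>o \<kappa>"
    using assms(1,2) card_of_mono1 ordLeq_ordIso_trans by blast
  then show ?thesis
    using assms(3) ordLeq_iff_ordLess_or_ordIso by blast
qed

lemma large_imp_nonempty: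
  assumes "Cinfinite \<kappa>" and "|J| =o \<kappa>"
  shows "J \<noteq> {}"
  using assms finite_small[OF assms(1), of J] not_ordLess_ordIso by auto

section \<open>Initial segments and cofinal sets\<close>

text \<open>
  Small sets are compared with initial segments of \<open>\<kappa>\<close>, so that the size of a small set is
  represented by an element of \<open>\<kappa>\<close> and bounds on sizes become bounds in \<open>\<kappa>\<close>.
\<close>

lemma small_imp_ordIso_underS:
  assumes "Card_order \<kappa>" and "|A| <o \<kappa>"
  obtains x where "x \<in> Field \<kappa>" and "|A| =o |underS \<kappa> x|"
proof -
  have w: "Well_order \<kappa>" "Well_order |A|"
    using assms(1) card_of_Well_order card_order_on_well_order_on by blast+
  obtain x where x: "x \<in> Field \<kappa>" "|A| =o Restr \<kappa> (underS \<kappa> x)"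
    using ordLess_iff_ordIso_Restr[OF w(1,2)] assms(2) by blast
  have "|Field |A|| =o |Field (Restr \<kappa> (underS \<kappa> x))|"
    using x(2) card_of_cong by blast
  moreover have "Field (Restr \<kappa> (underS \<kappa> x)) = underS \<kappa> x"
    using w(1) Field_Restr_ofilter wo_rel.intro wo_rel.underS_ofilter by metis
  ultimately have "|A| =o |underS \<kappa> x|" by (simp only: Field_card_of)
  with x show thesis using that by blast
qed

lemma not_above_imp_below:
  assumes "Card_order \<kappa>" and "x \<in> Field \<kappa>" "y \<in> Field \<kappa>" "\<not> (x \<noteq> y \<and> (x, y) \<in> \<kappa>)"
  shows "(y, x) \<in> \<kappa>"
  using assms unfolding card_order_on_def well_order_on_def linear_order_on_def total_on_def
    partial_order_on_def preorder_on_def refl_on_def by metis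

lemma Card_order_trans_antisym:
  assumes "Card_order \<kappa>"
  shows "trans \<kappa>" and "antisym \<kappa>"
  using assms by (auto simp: card_order_on_def well_order_on_def linear_order_on_def
        partial_order_on_def preorder_on_def)

lemma underS_mono:
  assumes "Card_order \<kappa>" and "(x, y) \<in> \<kappa>"
  shows "underS \<kappa> x \<subseteq> underS \<kappa> y"
  using Card_order_trans_antisym[OF assms(1)] assms(2) unfolding underS_def
  by (auto dest: transD antisymD)

lemma cofinal_infinite:
  assumes "Cinfinite \<kappa>" and "C \<subseteq> Field \<kappa>" and "cofinal C \<kappa>"
  shows "infinite C"
proof
  assume fin: "finite C"
  have "C = {}"
  proof (rule finite_transitivity_chain[OF fin, of "\<lambda>x y. x \<noteq> y \<and> (x, y) \<in> \<kappa>"])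
    show "\<not> (x \<noteq> x \<and> (x, x) \<in> \<kappa>)" for x by simp
    show "x \<noteq> z \<and> (x, z) \<in> \<kappa>" if "x \<noteq> y \<and> (x, y) \<in> \<kappa>" "y \<noteq> z \<and> (y, z) \<in> \<kappa>" for x y z
      using Card_order_trans_antisym[of \<kappa>] assms(1) that by (metis antisymD transD)
    show "\<exists>y. y \<in> C \<and> x \<noteq> y \<and> (x, y) \<in> \<kappa>" if "x \<in> C" for x
      using assms(2,3) that unfolding cofinal_def by blast
  qed
  moreover have "Field \<kappa> \<noteq> {}"
    using assms(1) by (auto simp: cinfinite_def)
  ultimately show False
    using assms(3) by (auto simp: cofinal_def)
qed

text \<open>
  A cofinal set of least cardinality need not have the order type of a cardinal, so it can have bounded
  subsets of full cardinality.  Well-order such a set in the type of its cardinality and keep only the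
  records, that is, the elements that exceed in \<open>\<kappa>\<close> everything enumerated earlier.  On the records the
  two orders agree, so a bounded set of records lies in a proper initial segment of the enumeration.
\<close>

lemma ex_cofinal_of_cofinality_type:
  assumes "Cinfinite \<kappa>"
  obtains C where "C \<subseteq> Field \<kappa>" and "cofinal C \<kappa>"
    and "\<And>B. B \<subseteq> Field \<kappa> \<Longrightarrow> cofinal B \<kappa> \<Longrightarrow> |C| \<le>o |B|"
    and "\<And>S. S \<subseteq> C \<Longrightarrow> \<not> cofinal S \<kappa> \<Longrightarrow> |S| <o |C|"
proof -
  have co: "Card_order \<kappa>" using assms by simp
  note tr = Card_order_trans_antisym(1)[OF co] and an = Card_order_trans_antisym(2)[OF co]
  let ?less = "\<lambda>x y. x \<noteq> y \<and> (x, y) \<in> \<kappa>"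
  obtain A where A: "A \<subseteq> Field \<kappa>" "cofinal A \<kappa>" "cofinality \<kappa> = |A|"
    using cofinality_least(1)[OF assms] by blast
  have minA: "|A| \<le>o |B|" if "B \<subseteq> Field \<kappa>" "cofinal B \<kappa>" for B
    using cofinality_least(2)[OF assms that] A(3) by simp
  define r where "r = |A|"
  have r: "Card_order r" "Field r = A" "Well_order r"
    unfolding r_def by (rule card_of_Card_order, rule Field_card_of, rule card_of_Well_order)
  \<comment> \<open>the records of the enumeration \<open>r\<close> of \<open>A\<close>\<close>
  define C where "C = {a \<in> A. \<forall>b\<in>A. b \<noteq> a \<and> (b, a) \<in> r \<longrightarrow> ?less b a}"
  have CA: "C \<subseteq> A" by (auto simp: C_def)
  \<comment> \<open>above every \<open>x\<close> there is a record, namely the first enumerated element above \<open>x\<close>\<close>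
  have first: "\<exists>c\<in>C. ?less x c \<and> (\<forall>b\<in>A. b \<noteq> c \<and> (b, c) \<in> r \<longrightarrow> \<not> ?less x b)"
    if x: "x \<in> Field \<kappa>" for x
  proof -
    let ?Q = "{a \<in> A. ?less x a}"
    have "?Q \<noteq> {}" using A(2) x by (auto simp: cofinal_def)
    moreover have wf: "wf (r - Id)"
      using r(3) well_order_on_def by blast
    ultimately obtain c where c: "c \<in> ?Q" "\<And>b. (b, c) \<in> r - Id \<Longrightarrow> b \<notin> ?Q"
      by (metis (no_types, lifting) all_not_in_conv wfE_min)
    have "?less b c" if b: "b \<in> A" "b \<noteq> c" "(b, c) \<in> r" for b
    proof -
      have "\<not> ?less x b" using c(2) b by auto
      then have "(b, x) \<in> \<kappa>"
        using not_above_imp_below[OF co x] A(1) b(1) by blast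
      then show ?thesis using c(1) tr b(2) by (auto dest: transD)
    qed
    then have "c \<in> C" using c(1) by (auto simp: C_def)
    then show ?thesis using c by blast
  qed
  have cof: "cofinal C \<kappa>"
    unfolding cofinal_def using first by blast
  have leq: "|C| \<le>o |A|" using CA card_of_mono1 by blast
  have "|A| \<le>o |C|"
    using minA[of C] cof CA A(1) by blast
  show thesis
  proof (rule that)
    show "C \<subseteq> Field \<kappa>" using CA A(1) by blast
    show "cofinal C \<kappa>" by (rule cof)
    show "|C| \<le>o |B|" if "B \<subseteq> Field \<kappa>" "cofinal B \<kappa>" for B
      using minA[OF that] leq ordLeq_transitive by blast
    show "|S| <o |C|" if S: "S \<subseteq> C" "\<not> cofinal S \<kappa>" for S
    proof -
      obtain x where x: "x \<in> Field \<kappa>" "\<And>s. s \<in> S \<Longrightarrow> \<not> ?less x s"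
        using S(2) by (auto simp: cofinal_def)
      obtain c where c: "c \<in> C" "?less x c" using first[OF x(1)] by blast
      have "S \<subseteq> underS r c"
      proof
        fix s assume s: "s \<in> S"
        have sx: "(s, x) \<in> \<kappa>"
          using not_above_imp_below[OF co x(1) _ x(2)[OF s]] s S(1) CA A(1) by blast
        have sA: "s \<in> A" "s \<noteq> c" using s S(1) CA c(2) x(2)[OF s] by blast+
        have "\<not> (c, s) \<in> r"
        proof
          assume "(c, s) \<in> r"
          moreover have "s \<in> C" "c \<in> A" using s S(1) c(1) CA by auto
          ultimately have "(c, s) \<in> \<kappa>"
            using sA(2) unfolding C_def by auto
          then have "(c, x) \<in> \<kappa>" using sx tr by (auto dest: transD)
          then show False using c(2) an by (auto dest: antisymD)
        qed
        then have "(s, c) \<in> r"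
          using not_above_imp_below[OF r(1), of c s] r(2) sA c(1) CA by blast
        then show "s \<in> underS r c" using sA by (auto simp: underS_def)
      qed
      moreover have "|underS r c| <o r"
        using card_of_underS[OF r(1)] c(1) CA r(2) by blast
      ultimately have "|S| <o |A|"
        using small_subset r_def by blast
      then show ?thesis using \<open>|A| \<le>o |C|\<close> ordLess_ordLeq_trans by blast
    qed
  qed
qed

section \<open>Free sets\<close>

text \<open>
  If a maximal free set \<open>S\<close> is small, then all \<open>a\<close> outside a small set satisfy \<open>p a \<notin> p ` S\<close> and
  \<open>p a \<notin> \<Union>(G ` S)\<close>, so that only \<open>G a\<close> meeting \<open>p ` S\<close> can keep \<open>a\<close> from being added to \<open>S\<close>.  Removing
  \<open>p ` S\<close> from these \<open>G a\<close> makes each of them smaller, and induction on the bound \<open>m\<close> yields a large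
  set that is free for the reduced sets; it is free for the original ones as well, because its
  points avoid \<open>p ` S\<close>.  Smallness is kept abstract, for it is measured against \<open>\<kappa>\<close> in one
  application and against the cofinality of \<open>\<kappa>\<close> in another.
\<close>

lemma free_set_modulo_ideal:
  fixes p :: "'b \<Rightarrow> 'l" and G :: "'b \<Rightarrow> 'l set" and small :: "'b set \<Rightarrow> bool"
  assumes mono: "\<And>S T. small T \<Longrightarrow> S \<subseteq> T \<Longrightarrow> small S"
    and un: "\<And>S T. small S \<Longrightarrow> small T \<Longrightarrow> small (S \<union> T)"
    and "\<And>a. a \<in> C \<Longrightarrow> finite (G a) \<and> card (G a) \<le> m \<and> p a \<notin> G a"
    and "\<And>S. S \<subseteq> C \<Longrightarrow> small S \<Longrightarrow> small {a \<in> C. p a \<in> p ` S \<union> \<Union>(G ` S)}"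
    and "\<not> small C"
  shows "\<exists>S\<subseteq>C. \<not> small S \<and> (\<forall>a\<in>S. \<forall>b\<in>S. p a \<notin> G b)"
  using assms(3-5)
proof (induction m arbitrary: C G)
  case 0
  have "\<forall>a\<in>C. G a = {}" using 0(1) card_0_eq by fastforce
  then show ?case using 0(3) by blast
next
  case (Suc m)
  let ?free = "{S. S \<subseteq> C \<and> (\<forall>a\<in>S. \<forall>b\<in>S. p a \<notin> G b)}"
  have "\<exists>S\<in>?free. \<forall>T\<in>?free. S \<subseteq> T \<longrightarrow> T = S"
  proof (rule subset_Zorn_nonempty)
    have "{} \<in> ?free" by simp
    then show "?free \<noteq> {}" by blast
    fix \<C> assume "\<C> \<noteq> {}" and ch: "subset.chain ?free \<C>"
    then have sub: "\<C> \<subseteq> ?free" and tot: "\<And>A B. A \<in> \<C> \<Longrightarrow> B \<in> \<C> \<Longrightarrow> A \<subseteq> B \<or> B \<subseteq> A"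
      by (auto simp: subset_chain_def)
    have "p a \<notin> G b" if "a \<in> \<Union>\<C>" "b \<in> \<Union>\<C>" for a b
    proof -
      obtain A B where AB: "A \<in> \<C>" "a \<in> A" "B \<in> \<C>" "b \<in> B"
        using \<open>a \<in> \<Union>\<C>\<close> \<open>b \<in> \<Union>\<C>\<close> by auto
      with tot[of A B] sub show ?thesis by blast
    qed
    moreover have "\<Union>\<C> \<subseteq> C" using sub by blast
    ultimately show "\<Union>\<C> \<in> ?free" by simp
  qed
  then obtain S where Sf: "S \<in> ?free" and mx: "\<forall>T\<in>?free. S \<subseteq> T \<longrightarrow> T = S" by (rule bexE)
  from Sf have S: "S \<subseteq> C" "\<And>a b. a \<in> S \<Longrightarrow> b \<in> S \<Longrightarrow> p a \<notin> G b" by simp_all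
  have max: "T = S" if "T \<in> ?free" "S \<subseteq> T" for T
    using bspec[OF mx that(1)] that(2) by (rule mp)
  show ?case
  proof (cases "small S")
    case False
    then show ?thesis using S by blast
  next
    case True
    define D where "D = {a \<in> C. p a \<in> p ` S \<union> \<Union>(G ` S)}"
    define H where "H a = G a - p ` S" for a
    have D: "small D" unfolding D_def using Suc.prems(2)[OF S(1) True] .
    have meets: "G a \<inter> p ` S \<noteq> {}" if a: "a \<in> C - D" for a
    proof
      assume no: "G a \<inter> p ` S = {}"
      have "insert a S \<in> ?free"
        using S no a Suc.prems(1)[of a] unfolding D_def by fastforce
      then have "a \<in> S" using max[of "insert a S"] by blast
      then show False using a by (auto simp: D_def)
    qed
    have "\<exists>R\<subseteq>C - D. \<not> small R \<and> (\<forall>a\<in>R. \<forall>b\<in>R. p a \<notin> H b)"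
    proof (rule Suc.IH)
      show "finite (H a) \<and> card (H a) \<le> m \<and> p a \<notin> H a" if a: "a \<in> C - D" for a
      proof -
        have "H a \<subset> G a" using meets[OF a] by (auto simp: H_def)
        then show ?thesis
          using a Suc.prems(1)[of a] psubset_card_mono[of "G a" "H a"]
          by (auto simp: H_def)
      qed
      show "small {a \<in> C - D. p a \<in> p ` R \<union> \<Union>(H ` R)}" if "R \<subseteq> C - D" "small R" for R
        by (rule mono[OF Suc.prems(2)[of R]]) (use that in \<open>auto simp: H_def\<close>)
      show "\<not> small (C - D)"
      proof
        assume "small (C - D)"
        then have "small ((C - D) \<union> D)" using un D by blast
        then show False using Suc.prems(3) mono by blast
      qed
    qed
    then obtain R where R: "R \<subseteq> C - D" "\<not> small R" "\<And>a b. a \<in> R \<Longrightarrow> b \<in> R \<Longrightarrow> p a \<notin> H b"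
      by blast
    have "p a \<notin> G b" if "a \<in> R" "b \<in> R" for a b
      using R(1) R(3)[OF that] that(1) by (auto simp: H_def D_def)
    then show ?thesis using R(1,2) by blast
  qed
qed

text \<open>
  The difficult case is the one in which neither a fibre of \<open>p\<close> nor the
  range of \<open>p\<close> has size \<open>\<kappa>\<close>.  Then the type of \<open>\<gamma>\<close>, the pair of \<open>p \<gamma>\<close> and \<open>G \<gamma> \<inter> p ` I\<close>, takes fewer than
  \<open>\<kappa>\<close> values.  Hence sets of constant type come in sizes unbounded in \<open>\<kappa>\<close>, and one of
  size above that of the segment below \<open>a\<close> can be attached to each \<open>a\<close> in a cofinal set \<open>C\<close>.  The
  free set theorem is applied to \<open>C\<close>, with smallness measured by \<open>|C|\<close>; a free
  set that is not small is cofinal, and so the sets attached to its elements have a union of size \<open>\<kappa>\<close>.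
\<close>

lemma large_free_set:
  fixes \<kappa> :: "'k rel" and I :: "'i set" and p :: "'i \<Rightarrow> 'l"
  assumes cinf: "Cinfinite \<kappa>" and I: "|I| =o \<kappa>"
    and G: "\<And>\<gamma>. \<gamma> \<in> I \<Longrightarrow> finite (G \<gamma>) \<and> card (G \<gamma>) \<le> m \<and> p \<gamma> \<notin> G \<gamma>"
  shows "\<exists>J\<subseteq>I. |J| =o \<kappa> \<and> (\<forall>\<gamma>\<in>J. \<forall>\<delta>\<in>J. p \<gamma> \<notin> G \<delta>)"
proof -
  have co: "Card_order \<kappa>" using cinf by simp
  note tr = Card_order_trans_antisym(1)[OF co]
  have large: "\<not> |I| <o \<kappa>" using I not_ordLess_ordIso by blast
  define P where "P = p ` I"
  define A where "A x = {\<gamma> \<in> I. p \<gamma> = x}" for x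
  consider (large_fibre) x where "\<not> |A x| <o \<kappa>"
    | (many_fibres) "\<not> |P| <o \<kappa>"
    | (few_small_fibres) "\<And>x. |A x| <o \<kappa>" "|P| <o \<kappa>"
    by blast
  then show ?thesis
  proof cases
    case large_fibre
    then have "|A x| =o \<kappa>"
      using large_subset_full_size[OF I] by (auto simp: A_def)
    moreover have "p \<gamma> \<notin> G \<delta>" if "\<gamma> \<in> A x" "\<delta> \<in> A x" for \<gamma> \<delta>
      using that G[of \<delta>] by (simp add: A_def)
    ultimately show ?thesis by (intro exI[of _ "A x"]) (auto simp: A_def)
  next
    case many_fibres
    obtain R where R: "R \<subseteq> I" "inj_on p R" "P = p ` R"
      using subset_image_inj[of P p I] unfolding P_def by auto
    have "\<exists>S\<subseteq>R. \<not> |S| <o \<kappa> \<and> (\<forall>a\<in>S. \<forall>b\<in>S. p a \<notin> G b)"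
    proof (rule free_set_modulo_ideal[where m = m])
      show "|S| <o \<kappa>" if "|T| <o \<kappa>" "S \<subseteq> T" for S T :: "'i set"
        using small_subset that by blast
      show "|S \<union> T| <o \<kappa>" if "|S| <o \<kappa>" "|T| <o \<kappa>" for S T :: "'i set"
        using small_Un[OF cinf] that by blast
      show "finite (G a) \<and> card (G a) \<le> m \<and> p a \<notin> G a" if "a \<in> R" for a
        using G[of a] R(1) that by blast
      show "\<not> |R| <o \<kappa>"
        using many_fibres R(3) small_image by blast
      show "|{a \<in> R. p a \<in> p ` S \<union> \<Union>(G ` S)}| <o \<kappa>" if S: "S \<subseteq> R" "|S| <o \<kappa>" for S
      proof -
        have "|\<Union>(G ` S)| <o \<kappa>"
          by (rule small_UN_finite[OF cinf S(2), of _ m]) (use G S(1) R(1) in blast)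
        then have Z: "|p ` S \<union> \<Union>(G ` S)| <o \<kappa>"
          using small_Un[OF cinf small_image[OF S(2)]] by blast
        have "inj_on p {a \<in> R. p a \<in> p ` S \<union> \<Union>(G ` S)}"
          using R(2) by (rule inj_on_subset) blast
        moreover have "p ` {a \<in> R. p a \<in> p ` S \<union> \<Union>(G ` S)} \<subseteq> p ` S \<union> \<Union>(G ` S)" by blast
        ultimately have "|{a \<in> R. p a \<in> p ` S \<union> \<Union>(G ` S)}| \<le>o |p ` S \<union> \<Union>(G ` S)|"
          using card_of_ordLeq by blast
        then show ?thesis using Z ordLeq_ordLess_trans by blast
      qed
    qed
    then obtain S where S: "S \<subseteq> R" "\<not> |S| <o \<kappa>" "\<forall>a\<in>S. \<forall>b\<in>S. p a \<notin> G b" by blast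
    then have "S \<subseteq> I" using R(1) by blast
    then show ?thesis using S(3) large_subset_full_size[OF I _ S(2)] by blast
  next
    case few_small_fibres
    obtain C where C: "C \<subseteq> Field \<kappa>" "cofinal C \<kappa>"
        "\<And>B. B \<subseteq> Field \<kappa> \<Longrightarrow> cofinal B \<kappa> \<Longrightarrow> |C| \<le>o |B|"
        "\<And>S. S \<subseteq> C \<Longrightarrow> \<not> cofinal S \<kappa> \<Longrightarrow> |S| <o |C|"
      using ex_cofinal_of_cofinality_type[OF cinf] by metis
    have cinfC: "Cinfinite |C|"
      using cofinal_infinite[OF cinf C(1,2)] by (simp add: cinfinite_def Field_card_of card_of_card_order_on)
    define ty where "ty \<gamma> = (p \<gamma>, G \<gamma> \<inter> P)" for \<gamma>
    define fib where "fib t = {\<gamma> \<in> I. ty \<gamma> = t}" for t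
    let ?Q = "{H. H \<subseteq> P \<and> finite H \<and> card H \<le> m}"
    have few_types: "|ty ` I| <o \<kappa>"
    proof (rule small_subset)
      show "|\<Union>x\<in>P. Pair x ` ?Q| <o \<kappa>"
        by (rule small_UNION[OF cinf few_small_fibres(2) small_bounded_subsets[OF cinf few_small_fibres(2)]])
          (rule card_of_image)
      have "G \<gamma> \<inter> P \<in> ?Q" if "\<gamma> \<in> I" for \<gamma>
        using G[OF that] card_mono[of "G \<gamma>" "G \<gamma> \<inter> P"] by auto
      then show "ty ` I \<subseteq> (\<Union>x\<in>P. Pair x ` ?Q)"
        unfolding ty_def P_def by blast
    qed
    \<comment> \<open>otherwise \<open>I\<close> would be a small union of sets of uniformly bounded small size\<close>
    have "\<exists>t. |underS \<kappa> a| <o |fib t|" if a: "a \<in> Field \<kappa>" for a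
    proof (rule ccontr)
      assume no: "\<nexists>t. |underS \<kappa> a| <o |fib t|"
      have le: "|fib t| \<le>o |underS \<kappa> a|" for t
        using no not_ordLess_iff_ordLeq[OF card_of_Well_order card_of_Well_order] by blast
      have "|\<Union>t\<in>ty ` I. fib t| <o \<kappa>"
        by (rule small_UNION[OF cinf few_types card_of_underS[OF co a]]) (rule le)
      moreover have "(\<Union>t\<in>ty ` I. fib t) = I" by (auto simp: fib_def)
      ultimately show False using large by simp
    qed
    then have "\<forall>a\<in>Field \<kappa>. \<exists>t. |underS \<kappa> a| <o |fib t|" by blast
    from bchoice[OF this] obtain t where t: "\<forall>a\<in>Field \<kappa>. |underS \<kappa> a| <o |fib (t a)|" by blast
    define q where "q a = fst (t a)" for a
    define H where "H a = snd (t a)" for a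
    have fibD: "\<gamma> \<in> I" "p \<gamma> = q a" "G \<gamma> \<inter> P = H a" if g: "\<gamma> \<in> fib (t a)" for \<gamma> a
    proof -
      have "t a = (p \<gamma>, G \<gamma> \<inter> P)" and "\<gamma> \<in> I" using g by (simp_all add: fib_def ty_def)
      then show "\<gamma> \<in> I" "p \<gamma> = q a" "G \<gamma> \<inter> P = H a" by (simp_all add: q_def H_def)
    qed
    have HC: "finite (H a) \<and> card (H a) \<le> m \<and> q a \<notin> H a" if a: "a \<in> C" for a
    proof -
      have "|underS \<kappa> a| <o |fib (t a)|" using t a C(1) by blast
      then have "fib (t a) \<noteq> {}" using card_of_empty not_ordLess_ordLeq by metis
      then obtain \<gamma> where g: "\<gamma> \<in> fib (t a)" by blast
      have "finite (G \<gamma> \<inter> P) \<and> card (G \<gamma> \<inter> P) \<le> m \<and> p \<gamma> \<notin> G \<gamma> \<inter> P"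
        using G[OF fibD(1)[OF g]] card_mono[of "G \<gamma>" "G \<gamma> \<inter> P"] by auto
      then show ?thesis unfolding fibD(2,3)[OF g] .
    qed
    have "\<exists>x. x \<in> Field \<kappa> \<and> |A z| \<le>o |underS \<kappa> x|" for z
      using small_imp_ordIso_underS[OF co few_small_fibres(1)[of z]] ordIso_imp_ordLeq by metis
    \<comment> \<open>\<open>bd z\<close> bounds in \<open>\<kappa>\<close> the size of the fibre over \<open>z\<close>\<close>
    then obtain bd where bd: "\<And>z. bd z \<in> Field \<kappa>" "\<And>z. |A z| \<le>o |underS \<kappa> (bd z)|" by metis
    have "\<exists>S\<subseteq>C. \<not> |S| <o |C| \<and> (\<forall>a\<in>S. \<forall>b\<in>S. q a \<notin> H b)"
    proof (rule free_set_modulo_ideal[where m = m])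
      show "|S| <o |C|" if "|T| <o |C|" "S \<subseteq> T" for S T :: "'k set"
        using small_subset that by blast
      show "|S \<union> T| <o |C|" if "|S| <o |C|" "|T| <o |C|" for S T :: "'k set"
        using small_Un[OF cinfC] that by blast
      show "finite (H a) \<and> card (H a) \<le> m \<and> q a \<notin> H a" if "a \<in> C" for a
        using HC that by blast
      show "\<not> |C| <o |C|" by (rule ordLess_irreflexive)
      show "|{a \<in> C. q a \<in> q ` S \<union> \<Union>(H ` S)}| <o |C|" if S: "S \<subseteq> C" "|S| <o |C|" for S
      proof -
        define Z where "Z = q ` S \<union> \<Union>(H ` S)"
        \<comment> \<open>A set smaller than \<open>C\<close> is not cofinal, so the fibres over \<open>Z\<close> have a common bound \<open>y\<close> in size, and\<close>
        \<comment> \<open>an index \<open>a\<close> above \<open>y\<close> carries too large a set to have its point in \<open>Z\<close>.\<close>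
        have "|\<Union>(H ` S)| <o |C|"
          by (rule small_UN_finite[OF cinfC S(2), of _ m]) (use HC S(1) in blast)
        then have "|Z| <o |C|"
          unfolding Z_def using small_Un[OF cinfC small_image[OF S(2)]] by blast
        then have "|bd ` Z| <o |C|" by (rule small_image)
        then have "\<not> cofinal (bd ` Z) \<kappa>"
          using C(3)[of "bd ` Z"] bd(1) not_ordLess_ordLeq by blast
        then obtain y where y: "y \<in> Field \<kappa>" "\<forall>b\<in>bd ` Z. \<not> (y \<noteq> b \<and> (y, b) \<in> \<kappa>)"
          unfolding cofinal_def by auto
        have "\<not> (y, a) \<in> \<kappa>" if a: "a \<in> C" "q a \<in> Z" for a
        proof
          assume "(y, a) \<in> \<kappa>"
          moreover have "(bd (q a), y) \<in> \<kappa>"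
            by (rule not_above_imp_below[OF co y(1) bd(1) bspec[OF y(2) imageI[OF a(2)]]])
          ultimately have "underS \<kappa> (bd (q a)) \<subseteq> underS \<kappa> a"
            using underS_mono[OF co] transD[OF tr] by blast
          moreover have "fib (t a) \<subseteq> A (q a)"
            using fibD by (auto simp: A_def)
          ultimately have "|fib (t a)| \<le>o |underS \<kappa> a|"
            using bd(2)[of "q a"] card_of_mono1 ordLeq_transitive by metis
          then show False using t a(1) C(1) not_ordLess_ordLeq by blast
        qed
        then have "\<not> cofinal {a \<in> C. q a \<in> Z} \<kappa>"
          using y(1) unfolding cofinal_def by blast
        then show ?thesis using C(4)[of "{a \<in> C. q a \<in> Z}"] unfolding Z_def by blast
      qed
    qed
    then obtain S where S: "S \<subseteq> C" "\<not> |S| <o |C|" "\<And>a b. a \<in> S \<Longrightarrow> b \<in> S \<Longrightarrow> q a \<notin> H b"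
      by blast
    define J where "J = (\<Union>a\<in>S. fib (t a))"
    have JI: "J \<subseteq> I" by (auto simp: J_def fib_def)
    have "\<not> |J| <o \<kappa>"
    proof
      assume "|J| <o \<kappa>"
      then obtain x where x: "x \<in> Field \<kappa>" "|J| =o |underS \<kappa> x|"
        using small_imp_ordIso_underS[OF co] by blast
      have "cofinal S \<kappa>" using C(4) S(1,2) by blast
      then obtain a where a: "a \<in> S" "(x, a) \<in> \<kappa>" using x(1) unfolding cofinal_def by blast
      have "|underS \<kappa> x| \<le>o |underS \<kappa> a|"
        by (rule card_of_mono1[OF underS_mono[OF co a(2)]])
      moreover have "|underS \<kappa> a| <o |fib (t a)|" using t a(1) S(1) C(1) by blast
      moreover have "|fib (t a)| \<le>o |J|"
        by (rule card_of_mono1) (use a(1) in \<open>auto simp: J_def\<close>)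
      ultimately have "|underS \<kappa> x| <o |J|"
        using ordLeq_ordLess_trans ordLess_ordLeq_trans by blast
      then show False using x(2) ordIso_symmetric not_ordLess_ordIso by blast
    qed
    then have "|J| =o \<kappa>" by (rule large_subset_full_size[OF I JI])
    moreover have "p \<gamma> \<notin> G \<delta>" if gd: "\<gamma> \<in> J" "\<delta> \<in> J" for \<gamma> \<delta>
    proof -
      obtain a b where ab: "a \<in> S" "b \<in> S" "\<gamma> \<in> fib (t a)" "\<delta> \<in> fib (t b)"
        using gd unfolding J_def by blast
      have "p \<gamma> \<in> P" using fibD(1)[OF ab(3)] by (simp add: P_def)
      moreover have "p \<gamma> \<notin> G \<delta> \<inter> P"
        unfolding fibD(2)[OF ab(3)] fibD(3)[OF ab(4)] by (rule S(3)[OF ab(1,2)])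
      ultimately show ?thesis by simp
    qed
    ultimately show ?thesis using JI by blast
  qed
qed

text \<open>
  Position \<open>k\<close> is separated from all the others by a set that is free for the points \<open>e \<gamma> k\<close> and the sets
  of the remaining coordinates of \<open>\<gamma>\<close>; separation passes to subfamilies, so the positions can be treated in
  turn.
\<close>

lemma large_family_separated_coordinates:
  fixes \<kappa> :: "'k rel" and I :: "'i set" and e :: "'i \<Rightarrow> nat \<Rightarrow> 'l"
  assumes cinf: "Cinfinite \<kappa>" and I: "|I| =o \<kappa>"
    and inj: "\<And>\<gamma>. \<gamma> \<in> I \<Longrightarrow> inj_on (e \<gamma>) {..<n}"
  shows "\<exists>J\<subseteq>I. |J| =o \<kappa> \<and>
    (\<forall>i<n. \<forall>j<n. \<forall>\<gamma>\<in>J. \<forall>\<delta>\<in>J. e \<gamma> i = e \<delta> j \<longrightarrow> i = j)"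
proof -
  have "\<exists>J\<subseteq>I. |J| =o \<kappa> \<and>
      (\<forall>i<k. \<forall>j<n. \<forall>\<gamma>\<in>J. \<forall>\<delta>\<in>J. e \<gamma> i = e \<delta> j \<longrightarrow> i = j)" if "k \<le> n" for k
    using that
  proof (induction k)
    case 0
    then show ?case using I by auto
  next
    case (Suc k)
    then obtain J where J: "J \<subseteq> I" "|J| =o \<kappa>"
        "\<And>i j \<gamma> \<delta>. i < k \<Longrightarrow> j < n \<Longrightarrow> \<gamma> \<in> J \<Longrightarrow> \<delta> \<in> J \<Longrightarrow> e \<gamma> i = e \<delta> j \<Longrightarrow> i = j"
      by (metis Suc_leD)
    have "\<exists>K\<subseteq>J. |K| =o \<kappa> \<and> (\<forall>\<gamma>\<in>K. \<forall>\<delta>\<in>K. e \<gamma> k \<notin> e \<delta> ` ({..<n} - {k}))"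
    proof (rule large_free_set[OF cinf J(2), where m = n])
      fix \<gamma> assume g: "\<gamma> \<in> J"
      have "card (e \<gamma> ` ({..<n} - {k})) \<le> card ({..<n} - {k})"
        by (rule card_image_le) simp
      also have "\<dots> \<le> card {..<n}" by (rule card_mono) auto
      finally have "card (e \<gamma> ` ({..<n} - {k})) \<le> n" by simp
      moreover have "e \<gamma> k \<notin> e \<gamma> ` ({..<n} - {k})"
        using inj[of \<gamma>] g J(1) Suc.prems by (auto simp: inj_on_def)
      ultimately show "finite (e \<gamma> ` ({..<n} - {k})) \<and> card (e \<gamma> ` ({..<n} - {k})) \<le> n \<and>
          e \<gamma> k \<notin> e \<gamma> ` ({..<n} - {k})" by simp
    qed
    then obtain K where K: "K \<subseteq> J" "|K| =o \<kappa>"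
        "\<And>\<gamma> \<delta>. \<gamma> \<in> K \<Longrightarrow> \<delta> \<in> K \<Longrightarrow> e \<gamma> k \<notin> e \<delta> ` ({..<n} - {k})"
      by blast
    have "i = j" if "i < Suc k" "j < n" "\<gamma> \<in> K" "\<delta> \<in> K" "e \<gamma> i = e \<delta> j" for i j \<gamma> \<delta>
    proof (cases "i = k")
      case True
      then show ?thesis using K(3)[OF that(3,4)] that(2,5) by blast
    next
      case False
      then show ?thesis using J(3)[of i j \<gamma> \<delta>] that K(1) by auto
    qed
    then show ?case using K(1,2) J(1) by (intro exI[of _ K]) blast
  qed
  then show ?thesis by blast
qed

section \<open>Uncountable cofinality\<close>

text \<open>
  If all classes were small, countably many elements of \<open>\<kappa>\<close> would represent their sizes.  These elements
  are not cofinal, so the classes have a common small bound, and a countable union of them cannot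
  be all of \<open>I\<close>.
\<close>

lemma uncountable_cofinality_pigeonhole:
  fixes \<kappa> :: "'k rel" and I :: "'i set" and f :: "'i \<Rightarrow> nat"
  assumes cinf: "Cinfinite \<kappa>" and cof: "natLeq <o cofinality \<kappa>" and I: "|I| =o \<kappa>"
  shows "\<exists>n. |{\<gamma> \<in> I. f \<gamma> = n}| =o \<kappa>"
proof (rule ccontr)
  assume no: "\<nexists>n. |{\<gamma> \<in> I. f \<gamma> = n}| =o \<kappa>"
  let ?A = "\<lambda>n. {\<gamma> \<in> I. f \<gamma> = n}"
  have co: "Card_order \<kappa>" using cinf by simp
  have "|?A n| <o \<kappa>" for n
    using large_subset_full_size[OF I, of "?A n"] no by blast
  then have "\<exists>x. x \<in> Field \<kappa> \<and> |?A n| \<le>o |underS \<kappa> x|" for n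
    using small_imp_ordIso_underS[OF co] ordIso_imp_ordLeq by metis
  then obtain x where x: "\<And>n. x n \<in> Field \<kappa>" "\<And>n. |?A n| \<le>o |underS \<kappa> (x n)|" by metis
  have "|range x| \<le>o natLeq"
    using card_of_image card_of_nat ordLeq_ordIso_trans by blast
  then have "|range x| <o cofinality \<kappa>" using cof ordLeq_ordLess_trans by blast
  then have "\<not> cofinal (range x) \<kappa>"
    using cofinality_least(2)[OF cinf, of "range x"] x(1) not_ordLess_ordLeq by blast
  then obtain y where y: "y \<in> Field \<kappa>" "\<And>n. \<not> (y \<noteq> x n \<and> (y, x n) \<in> \<kappa>)"
    unfolding cofinal_def by blast
  have le: "|?A n| \<le>o |underS \<kappa> y|" for n
    using x(2)[of n] card_of_mono1[OF underS_mono[OF co not_above_imp_below[OF co y(1) x(1) y(2)]]]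
      ordLeq_transitive by blast
  obtain B where B: "B \<subseteq> Field \<kappa>" "cofinality \<kappa> = |B|"
    using cofinality_least(1)[OF cinf] by blast
  have "cofinality \<kappa> \<le>o \<kappa>"
    unfolding B(2) using card_of_mono1[OF B(1)] card_of_Field_ordIso[OF co] ordLeq_ordIso_trans by blast
  then have nat: "|UNIV :: nat set| <o \<kappa>"
    using cof card_of_nat ordIso_ordLess_trans ordLess_ordLeq_trans by blast
  have "|\<Union>n. ?A n| <o \<kappa>"
    by (rule small_UNION[OF cinf nat card_of_underS[OF co y(1)]]) (rule le)
  moreover have "(\<Union>n. ?A n) = I" by auto
  ultimately show False using I not_ordLess_ordIso by auto
qed

section \<open>Precalibers of powers\<close>

lemma centered_subset:
  assumes "centered U J" and "K \<subseteq> J" and "K \<noteq> {}"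
  shows "centered U K"
  using assms unfolding centered_def by blast

text \<open>
  Being centered passes to non-empty subfamilies, so the precaliber can be applied to one family
  after the other.
\<close>

lemma precaliber_finitely_many_families:
  fixes \<kappa> :: "'k rel" and I :: "'k set" and n :: nat
  assumes cinf: "Cinfinite \<kappa>" and pre: "has_precaliber X \<kappa>" and I: "|I| =o \<kappa>"
    and W: "\<And>\<gamma> i. \<gamma> \<in> I \<Longrightarrow> i < n \<Longrightarrow> W \<gamma> i \<in> nonempty_opens X"
  shows "\<exists>J\<subseteq>I. |J| =o \<kappa> \<and> (\<forall>i<n. centered (\<lambda>\<gamma>. W \<gamma> i) J)"
  using W
proof (induction n)
  case 0
  then show ?case using I by auto
next
  case (Suc n)
  have "\<exists>J\<subseteq>I. |J| =o \<kappa> \<and> (\<forall>i<n. centered (\<lambda>\<gamma>. W \<gamma> i) J)"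
    by (rule Suc.IH) (simp add: Suc.prems)
  then obtain J where J: "J \<subseteq> I" "|J| =o \<kappa>" "\<And>i. i < n \<Longrightarrow> centered (\<lambda>\<gamma>. W \<gamma> i) J"
    by blast
  have "\<forall>\<gamma>\<in>J. W \<gamma> n \<in> nonempty_opens X" using J(1) Suc.prems by blast
  then obtain K where K: "K \<subseteq> J" "|K| =o \<kappa>" "centered (\<lambda>\<gamma>. W \<gamma> n) K"
    using has_precaliber_any_index_type[OF pre _ J(2)] cinf by metis
  have "centered (\<lambda>\<gamma>. W \<gamma> i) K" if "i < Suc n" for i
  proof (cases "i = n")
    case True
    then show ?thesis using K(3) by simp
  next
    case False
    then have "i < n" using that by simp
    then show ?thesis
      by (rule centered_subset[OF J(3) K(1) large_imp_nonempty[OF cinf K(2)]])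
  qed
  then show ?case using K(1,2) J(1) by (intro exI[of _ K]) auto
qed

theorem theorem3p2:
  fixes X :: "'a topology" and \<kappa> :: "'k rel" and \<mu> :: "'l rel"
  assumes "infinite (topspace X)"
    and "Cinfinite \<kappa>" and "Cinfinite \<mu>"
    and "has_precaliber X \<kappa>"
    and "natLeq <o cofinality \<kappa>"
  shows "has_precaliber (topological_power X \<mu>) \<kappa>"
  unfolding has_precaliber_def
proof (intro allI impI)
  fix I :: "'k set" and U :: "'k \<Rightarrow> ('l \<Rightarrow> 'a) set"
  assume "|I| =o \<kappa> \<and> (\<forall>\<gamma>\<in>I. U \<gamma> \<in> nonempty_opens (topological_power X \<mu>))"
  then have I: "|I| =o \<kappa>" and U: "\<And>\<gamma>. \<gamma> \<in> I \<Longrightarrow> U \<gamma> \<in> nonempty_opens (topological_power X \<mu>)"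
    by auto
  define L where "L = Field \<mu>"
  have "\<exists>V. finite {l \<in> L. V l \<noteq> topspace X} \<and> (\<forall>l\<in>L. openin X (V l)) \<and>
      Pi\<^sub>E L V \<noteq> {} \<and> Pi\<^sub>E L V \<subseteq> U \<gamma>" if g: "\<gamma> \<in> I" for \<gamma>
  proof -
    obtain x where x: "x \<in> U \<gamma>" and "openin (product_topology (\<lambda>_. X) L) (U \<gamma>)"
      using U[OF g] by (auto simp: nonempty_opens_def topological_power_def L_def)
    from bspec[OF this(2)[unfolded openin_product_topology_alt] x] obtain V where
      "finite {l \<in> L. V l \<noteq> topspace X}" "\<forall>l\<in>L. openin X (V l)" "x \<in> Pi\<^sub>E L V" "Pi\<^sub>E L V \<subseteq> U \<gamma>"
      by (elim exE conjE)
    then show ?thesis by (intro exI[of _ V]) auto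
  qed
  then have "\<forall>\<gamma>\<in>I. \<exists>V. finite {l \<in> L. V l \<noteq> topspace X} \<and> (\<forall>l\<in>L. openin X (V l)) \<and>
      Pi\<^sub>E L V \<noteq> {} \<and> Pi\<^sub>E L V \<subseteq> U \<gamma>" by blast
  from bchoice[OF this] obtain V where
    V: "\<forall>\<gamma>\<in>I. finite {l \<in> L. V \<gamma> l \<noteq> topspace X} \<and> (\<forall>l\<in>L. openin X (V \<gamma> l)) \<and>
      Pi\<^sub>E L (V \<gamma>) \<noteq> {} \<and> Pi\<^sub>E L (V \<gamma>) \<subseteq> U \<gamma>" by blast
  define supp where "supp \<gamma> = {l \<in> L. V \<gamma> l \<noteq> topspace X}" for \<gamma>
  have fin: "finite (supp \<gamma>)" if "\<gamma> \<in> I" for \<gamma>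
    using V that by (simp add: supp_def)
  have opens: "V \<gamma> l \<in> nonempty_opens X" if "\<gamma> \<in> I" "l \<in> L" for \<gamma> l
    using V that by (auto simp: nonempty_opens_def PiE_eq_empty_iff)
  obtain n where n: "|{\<gamma> \<in> I. card (supp \<gamma>) = n}| =o \<kappa>"
    using uncountable_cofinality_pigeonhole[OF assms(2,5) I, of "\<lambda>\<gamma>. card (supp \<gamma>)"] by blast
  define I\<^sub>n where "I\<^sub>n = {\<gamma> \<in> I. card (supp \<gamma>) = n}"
  have In: "|I\<^sub>n| =o \<kappa>" "I\<^sub>n \<subseteq> I" using n by (auto simp: I\<^sub>n_def)
  have "\<exists>e. bij_betw e {..<n} (supp \<gamma>)" if "\<gamma> \<in> I\<^sub>n" for \<gamma>
    using ex_bij_betw_nat_finite[OF fin, of \<gamma>] that by (auto simp: I\<^sub>n_def atLeast0LessThan)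
  then have "\<forall>\<gamma>\<in>I\<^sub>n. \<exists>e. bij_betw e {..<n} (supp \<gamma>)" by blast
  from bchoice[OF this] obtain e where e: "\<forall>\<gamma>\<in>I\<^sub>n. bij_betw (e \<gamma>) {..<n} (supp \<gamma>)" by blast
  obtain J where J: "J \<subseteq> I\<^sub>n" "|J| =o \<kappa>"
      "\<And>i j \<gamma> \<delta>. i < n \<Longrightarrow> j < n \<Longrightarrow> \<gamma> \<in> J \<Longrightarrow> \<delta> \<in> J \<Longrightarrow> e \<gamma> i = e \<delta> j \<Longrightarrow> i = j"
    using large_family_separated_coordinates[OF assms(2) In(1), of e n] e
    by (metis bij_betw_def)
  have eL: "e \<gamma> i \<in> L" if "\<gamma> \<in> J" "i < n" for \<gamma> i
    using e J(1) that by (force simp: bij_betw_def supp_def)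
  have "\<exists>K\<subseteq>J. |K| =o \<kappa> \<and> (\<forall>i<n. centered (\<lambda>\<gamma>. V \<gamma> (e \<gamma> i)) K)"
    by (rule precaliber_finitely_many_families[OF assms(2,4) J(2)])
      (use opens eL J(1) In(2) in blast)
  then obtain K where K: "K \<subseteq> J" "|K| =o \<kappa>" "\<And>i. i < n \<Longrightarrow> centered (\<lambda>\<gamma>. V \<gamma> (e \<gamma> i)) K"
    by blast
  have "(\<Inter>\<gamma>\<in>F. U \<gamma>) \<noteq> {}" if F: "F \<subseteq> K" "F \<noteq> {}" "finite F" for F
  proof -
    have "(\<Inter>\<gamma>\<in>F. V \<gamma> (e \<gamma> i)) \<noteq> {}" if "i < n" for i
      using K(3)[OF that] F by (simp add: centered_def)
    then have "\<exists>x. \<forall>\<gamma>\<in>F. x \<in> V \<gamma> (e \<gamma> i)" if "i < n" for i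
      using that by fast
    then obtain x where x: "\<And>i \<gamma>. i < n \<Longrightarrow> \<gamma> \<in> F \<Longrightarrow> x i \<in> V \<gamma> (e \<gamma> i)" by metis
    obtain x\<^sub>0 where x0: "x\<^sub>0 \<in> topspace X"
      using assms(1) by (metis finite.emptyI ex_in_conv)
    \<comment> \<open>\<open>addr l i\<close>: the coordinate \<open>l\<close> is the \<open>i\<close>-th one of some box of \<open>F\<close>; by separation \<open>i\<close> is unique\<close>
    \<comment> \<open>and \<open>x\<^sub>0\<close> is an arbitrary value for the coordinates outside the supports of these boxes\<close>
    define addr where "addr l i \<longleftrightarrow> i < n \<and> (\<exists>\<gamma>\<in>F. l = e \<gamma> i)" for l i
    define y where "y = (\<lambda>l\<in>L. if \<exists>i. addr l i then x (THE i. addr l i) else x\<^sub>0)"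
    have addr: "(THE j. addr l j) = i" if i: "addr l i" for l i
    proof (rule the_equality[where P = "addr l", OF i])
      fix j assume "addr l j"
      then obtain \<gamma> \<delta> where "\<gamma> \<in> F" "l = e \<gamma> i" "i < n" "\<delta> \<in> F" "l = e \<delta> j" "j < n"
        using i by (auto simp: addr_def)
      moreover from this have "\<gamma> \<in> J" "\<delta> \<in> J" using F(1) K(1) by auto
      ultimately show "j = i" using J(3)[of j i \<delta> \<gamma>] by simp
    qed
    have "y \<in> Pi\<^sub>E L (V \<gamma>)" if g: "\<gamma> \<in> F" for \<gamma>
    proof (rule PiE_I)
      fix l assume l: "l \<in> L"
      have gI: "\<gamma> \<in> I\<^sub>n" using g F(1) K(1) J(1) by blast
      show "y l \<in> V \<gamma> l"
      proof (cases "l \<in> supp \<gamma>")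
        case True
        then obtain i where i: "i < n" "l = e \<gamma> i"
          using e gI unfolding bij_betw_def by blast
        then have "addr l i" using g by (auto simp: addr_def)
        then have "y l = x i" using addr[of l i] l by (auto simp: y_def)
        then show ?thesis using x[OF i(1) g] i(2) by simp
      next
        case False
        then have top: "V \<gamma> l = topspace X" using l by (simp add: supp_def)
        show ?thesis
        proof (cases "\<exists>i. addr l i")
          case True
          then obtain i \<delta> where i: "addr l i" "i < n" "\<delta> \<in> F" by (auto simp: addr_def)
          then have "x i \<in> V \<delta> (e \<delta> i)" using x by blast
          moreover have "V \<delta> (e \<delta> i) \<subseteq> topspace X"
            using opens[of \<delta> "e \<delta> i"] eL[of \<delta> i] i F(1) K(1) J(1) In(2)
            by (auto simp: nonempty_opens_def dest: openin_subset)
          ultimately show ?thesis using top addr[OF i(1)] l True by (auto simp: y_def)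
        next
          case False
          then show ?thesis using top x0 l by (auto simp: y_def)
        qed
      qed
    qed (simp add: y_def)
    then have "y \<in> U \<gamma>" if "\<gamma> \<in> F" for \<gamma>
      using V that F(1) K(1) J(1) In(2) by blast
    then show ?thesis by blast
  qed
  then have "centered U K"
    using large_imp_nonempty[OF assms(2) K(2)] unfolding centered_def by blast
  then show "\<exists>J. J \<subseteq> I \<and> |J| =o \<kappa> \<and> centered U J"
    using K(1,2) J(1) In(2) by blast
qed

end
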